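(* Let $0<q<1$, $0\le a<b<\infty$, $\alpha>0$ and $1\le p<\infty$. Then the fractional integration operator $I^\alpha_{q,a+}$ is bounded in $L^p_q[a,b]$: for every $f\in L^p_q[a,b]$, $$\|I^\alpha_{q,a+}f\|_{L^p_q[a,b]}\le K\|f\|_{L^p_q[a,b]},\qquad K:=\frac{(b-qa)_q^\alpha}{\Gamma_q(\alpha+1)}.$$
   Context: Fix $0<q<1$ and $0\le a<b<\infty$. $(z;q)_\infty=\prod_{k=0}^\infty(1-q^kz)$. The $q$-power is $(x-y)_q^\alpha=x^\alpha\dfrac{(y/x;q)_\infty}{(q^\alpha y/x;q)_\infty}$. The $q$-gamma function is $\Gamma_q(x)=\dfrac{(q;q)_\infty}{(q^x;q)_\infty}(1-q)^{1-x}$. Jackson integral: $\int_0^cf(x)\,d_qx=(1-q)c\sum_{m=0}^\infty q^mf(cq^m)$ and $\int_a^bf\,d_qx=\int_0^bf\,d_qx-\int_0^af\,d_qx$. Functions are understood to be defined at all points at which such integrals evaluate them. $L^p_q[a,b]$ is the set of real functions $f$ with $\|f\|_{L^p_q[a,b]}=\left(\int_a^b|f(x)|^p\,d_qx\right)^{1/p}<\infty$. Riemann–Liouville $q$-fractional integral of order $\alpha>0$: $(I^\alpha_{q,a+}f)(x)=\dfrac1{\Gamma_q(\alpha)}\int_a^x(x-qt)_q^{\alpha-1}f(t)\,d_qt$.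
   Formalization: The formal theorem assumes that the q-integral of |f|^p over [a,b] is nonnegative for every f in L^p_q[a,b], equivalently a=0 or a=bq^n for some n; for other a the "norm" is not well defined and the stated bound fails. *)

theory Defs
  imports "HOL-Analysis.Analysis"
begin

definition qpoch :: "real \<Rightarrow> real \<Rightarrow> real" where
  "qpoch z q = (\<Prod>k. 1 - q ^ k * z)"

text \<open>\<open>qpower q x y \<alpha>\<close> is \<open>(x - y)\<^sub>q\<^sup>\<alpha>\<close>; the two terms are separate arguments because the value is
  not a function of the difference.\<close>

definition qpower :: "real \<Rightarrow> real \<Rightarrow> real \<Rightarrow> real \<Rightarrow> real" where
  "qpower q x y \<alpha> = x powr \<alpha> * (qpoch (y / x) q / qpoch (q powr \<alpha> * (y / x)) q)"

definition qGamma :: "real \<Rightarrow> real \<Rightarrow> real" where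
  "qGamma q x = qpoch q q / qpoch (q powr x) q * (1 - q) powr (1 - x)"

definition jackson0 :: "real \<Rightarrow> real \<Rightarrow> (real \<Rightarrow> real) \<Rightarrow> real" where
  "jackson0 q c f = (1 - q) * c * (\<Sum>m. q ^ m * f (c * q ^ m))"

definition jackson :: "real \<Rightarrow> real \<Rightarrow> real \<Rightarrow> (real \<Rightarrow> real) \<Rightarrow> real" where
  "jackson q a b f = jackson0 q b f - jackson0 q a f"

definition jackson_integrable :: "real \<Rightarrow> real \<Rightarrow> real \<Rightarrow> (real \<Rightarrow> real) \<Rightarrow> bool" where
  "jackson_integrable q a b f \<longleftrightarrow>
     summable (\<lambda>m. q ^ m * f (b * q ^ m)) \<and> summable (\<lambda>m. q ^ m * f (a * q ^ m))"

text \<open>Finiteness of the norm means that both series in the Jackson integral of \<open>\<bar>f\<bar>\<^sup>p\<close> converge;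
  without this \<open>suminf\<close> is an unspecified number.\<close>

definition Lq :: "real \<Rightarrow> real \<Rightarrow> real \<Rightarrow> real \<Rightarrow> (real \<Rightarrow> real) set" where
  "Lq q p a b = {f. jackson_integrable q a b (\<lambda>x. \<bar>f x\<bar> powr p)}"

definition Lq_norm :: "real \<Rightarrow> real \<Rightarrow> real \<Rightarrow> real \<Rightarrow> (real \<Rightarrow> real) \<Rightarrow> real" where
  "Lq_norm q p a b f = (jackson q a b (\<lambda>x. \<bar>f x\<bar> powr p)) powr (1 / p)"

text \<open>The Jackson integral over \<open>[a, b]\<close> is a difference of two series, so for \<open>a > 0\<close> the integral of
  \<open>\<bar>f\<bar>\<^sup>p\<close> may be negative, and then its power with exponent \<open>1 / p\<close> is not a norm. The predicate below
  states the presupposition of the notation that \<open>\<parallel>f\<parallel>\<close> is the \<open>p\<close>-th root of a nonnegative number for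
  every \<open>f\<close> in the space. The lemma \<open>Lq_norm_well_defined_iff\<close> describes it in terms of \<open>a\<close> and \<open>b\<close>.
  Boundedness of the fractional integral fails without it: for \<open>q = 1/2\<close>, \<open>\<alpha> = p = 1\<close>, \<open>a = 1\<close>,
  \<open>b = 3\<close>, the function with \<open>f 3 = 1\<close>, \<open>f 1 = -3\<close> and zero elsewhere has \<open>\<parallel>f\<parallel> = 0\<close>, but
  its integral of order \<open>1\<close> has positive norm.\<close>

definition Lq_norm_well_defined :: "real \<Rightarrow> real \<Rightarrow> real \<Rightarrow> real \<Rightarrow> bool" where
  "Lq_norm_well_defined q p a b \<longleftrightarrow>
     (\<forall>f \<in> Lq q p a b. 0 \<le> jackson q a b (\<lambda>x. \<bar>f x\<bar> powr p))"

definition RL_qint :: "real \<Rightarrow> real \<Rightarrow> real \<Rightarrow> (real \<Rightarrow> real) \<Rightarrow> real \<Rightarrow> real" where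
  "RL_qint q \<alpha> a f x = 1 / qGamma q \<alpha> * jackson q a x (\<lambda>t. qpower q x (q * t) (\<alpha> - 1) * f t)"

lemma Lq_norm_well_defined_iff:
  fixes q p a b :: real
  assumes q: "0 < q" "q < 1" and ab: "0 \<le> a" "a < b"
  shows "Lq_norm_well_defined q p a b \<longleftrightarrow> a = 0 \<or> (\<exists>n. a = b * q ^ n)"
proof
  assume wd: "Lq_norm_well_defined q p a b"
  show "a = 0 \<or> (\<exists>n. a = b * q ^ n)"
  proof (rule ccontr)
    assume neg: "\<not> ?thesis"
    define f where "f x = (if x = a then 1 else 0 :: real)" for x
    have fb: "(\<lambda>m. q ^ m * \<bar>f (b * q ^ m)\<bar> powr p) = (\<lambda>m. 0)"
      using neg by (auto simp: f_def fun_eq_iff)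
    have "q ^ m = 1 \<longleftrightarrow> m = 0" for m
    proof (cases m)
      case (Suc k)
      then show ?thesis using q power_Suc_less_one[of q k] by simp
    qed simp
    then have "q ^ m * \<bar>f (a * q ^ m)\<bar> powr p = (if m = 0 then 1 else 0)" for m
      using neg by (auto simp: f_def)
    then have fa: "(\<lambda>m. q ^ m * \<bar>f (a * q ^ m)\<bar> powr p) sums 1"
      using sums_single[of 0 "\<lambda>_. 1::real"] by simp
    have "f \<in> Lq q p a b"
      using fa by (simp add: Lq_def jackson_integrable_def fb sums_iff)
    moreover have "jackson q a b (\<lambda>x. \<bar>f x\<bar> powr p) = - ((1 - q) * a)"
      using fa by (simp add: jackson_def jackson0_def fb sums_iff)
    moreover have "(1 - q) * a > 0" using neg q ab by simp
    ultimately show False using wd by (force simp: Lq_norm_well_defined_def)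
  qed
next
  assume grid: "a = 0 \<or> (\<exists>n. a = b * q ^ n)"
  show "Lq_norm_well_defined q p a b"
    unfolding Lq_norm_well_defined_def
  proof
    fix f assume f: "f \<in> Lq q p a b"
    define F where "F = (\<lambda>m. q ^ m * \<bar>f (b * q ^ m)\<bar> powr p)"
    have nn: "0 \<le> F m" for m using q by (simp add: F_def)
    have sF: "summable F" using f unfolding Lq_def jackson_integrable_def F_def by simp
    have jb: "jackson0 q b (\<lambda>x. \<bar>f x\<bar> powr p) = (1 - q) * b * suminf F"
      by (simp add: jackson0_def F_def)
    consider "a = 0" | n where "a = b * q ^ n" using grid by blast
    then show "0 \<le> jackson q a b (\<lambda>x. \<bar>f x\<bar> powr p)"
    proof cases
      case 1
      then show ?thesis using q ab suminf_nonneg[OF sF nn]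
        by (simp add: jackson_def jb) (simp add: jackson0_def)
    next
      case 2
      have sG: "summable (\<lambda>m. q ^ m * \<bar>f (a * q ^ m)\<bar> powr p)"
        using f by (simp add: Lq_def jackson_integrable_def)
      have "F (m + n) = q ^ n * (q ^ m * \<bar>f (a * q ^ m)\<bar> powr p)" for m
        by (simp add: F_def 2 power_add mult_ac)
      then have "(\<Sum>m. F (m + n)) = q ^ n * (\<Sum>m. q ^ m * \<bar>f (a * q ^ m)\<bar> powr p)"
        using suminf_mult[OF sG, of "q ^ n"] by simp
      then have "jackson0 q a (\<lambda>x. \<bar>f x\<bar> powr p) = (1 - q) * b * (\<Sum>m. F (m + n))"
        by (simp add: jackson0_def 2)
      moreover have "suminf F - (\<Sum>m. F (m + n)) \<ge> 0"
        using suminf_split_initial_segment[OF sF, of n] sum_nonneg[of "{..<n}" F] nn by simp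
      ultimately show ?thesis using q ab
        by (simp add: jackson_def jb mult_left_mono)
    qed
  qed
qed

end

theory Submission
  imports Defs
begin

text \<open>By hypothesis \<open>a = 0\<close> or \<open>a = b q\<^sup>n\<close>, so all norms and integrals live on the grid \<open>b q\<^sup>m > a\<close>: the
  contributions of \<open>[0, a]\<close> cancel, and the kernel vanishes for \<open>t > x\<close>. On the grid the fractional
  integral is an upper triangular matrix with nonnegative entries acting on \<open>\<ell>\<^sup>p\<close> with weights \<open>q\<^sup>m\<close>.
  Its row sums are the values at \<open>x\<close> of \<open>(x - a)\<^sub>q\<^sup>\<alpha> / \<Gamma>\<^sub>q(\<alpha> + 1)\<close>, its weighted column sums those of
  \<open>(b - q t)\<^sub>q\<^sup>\<alpha> / \<Gamma>\<^sub>q(\<alpha> + 1)\<close>; both sums telescope and are bounded by \<open>K\<close>, and the Schur test applies.\<close>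

section \<open>A Schur test for weighted sequence spaces\<close>

text \<open>The tangent to the convex function \<open>y powr p\<close> at \<open>c\<close>,
  rearranged. Young's inequality for \<open>y powr p\<close> and \<open>c powr p\<close> with
  weights \<open>1 / p\<close> and \<open>1 - 1 / p\<close>, multiplied by \<open>p\<close>, gives
  it.\<close>

lemma powr_tangent_le:
  fixes p c y :: real
  assumes "1 \<le> p" "0 < c" "0 \<le> y"
  shows "p * c powr (p - 1) * y \<le> y powr p + (p - 1) * c powr p"
proof (cases "y = 0")
  case False
  have e: "p * (1 - 1 / p) = p - 1" using assms by (simp add: field_simps)
  have "(y powr p) powr (1 / p) * (c powr p) powr (1 - 1 / p)
          \<le> 1 / p * y powr p + (1 - 1 / p) * c powr p"
  proof (rule Youngs_inequality_0)
    show "0 \<le> 1 - 1 / p" using assms by (simp add: divide_le_eq)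
    show "1 / p + (1 - 1 / p) = 1" by linarith
  qed (use assms False in auto)
  moreover have "(y powr p) powr (1 / p) = y" using assms False by (simp add: powr_powr)
  moreover have "(c powr p) powr (1 - 1 / p) = c powr (p - 1)" by (simp only: powr_powr e)
  ultimately have "p * (y * c powr (p - 1)) \<le> p * (1 / p * y powr p + (1 - 1 / p) * c powr p)"
    using assms by (intro mult_left_mono) auto
  also have "\<dots> = y powr p + (p * (1 - 1 / p)) * c powr p"
    using assms by (simp only: distrib_left mult.assoc[symmetric]) simp
  finally show ?thesis unfolding e by (simp only: mult_ac)
qed (use assms in simp)

text \<open>Against summable weights, this turns summability of p-th powers into absolute
  summability.\<close>

lemma abs_le_one_plus_powr:
  fixes p y :: real
  assumes "1 \<le> p"
  shows "\<bar>y\<bar> \<le> 1 + \<bar>y\<bar> powr p"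
proof (cases "\<bar>y\<bar> \<le> 1")
  case True
  then show ?thesis by (simp add: add_increasing2)
next
  case False
  then have "\<bar>y\<bar> powr 1 \<le> \<bar>y\<bar> powr p" using assms by (intro powr_mono) auto
  then show ?thesis using False by simp
qed

text \<open>Jensen's inequality for weights whose mass is only bounded by \<open>K\<close>, by
  summing the tangent inequality: the mass enters with the nonnegative factor
  \<open>(p - 1) * c powr p\<close> and may be replaced by \<open>K\<close>.\<close>

lemma jensen_powr_suminf:
  fixes A g :: "nat \<Rightarrow> real" and K p :: real
  assumes p: "1 \<le> p" and K: "0 < K" and A: "\<And>k. 0 \<le> A k"
    and sA: "summable A" and AK: "suminf A \<le> K"
    and sB: "summable (\<lambda>k. A k * \<bar>g k\<bar> powr p)"
  shows "\<bar>\<Sum>k. A k * g k\<bar> powr p \<le> K powr (p - 1) * (\<Sum>k. A k * \<bar>g k\<bar> powr p)"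
proof -
  have sAg: "summable (\<lambda>k. \<bar>A k * g k\<bar>)"
  proof (rule summable_comparison_test'[OF summable_add[OF sA sB], of 0])
    fix k
    show "norm \<bar>A k * g k\<bar> \<le> A k + A k * \<bar>g k\<bar> powr p"
      using mult_left_mono[OF abs_le_one_plus_powr[OF p, of "g k"] A[of k]] A[of k]
      by (simp add: abs_mult distrib_left)
  qed
  \<comment> \<open>The tangent point is the mean of |g| as if the mass were exactly
    \<open>K\<close>; the linear terms then sum to \<open>p * K * c powr p\<close>.\<close>
  define c where "c = (\<Sum>k. \<bar>A k * g k\<bar>) / K"
  have Kc: "(\<Sum>k. \<bar>A k * g k\<bar>) = K * c" using K by (simp add: c_def)
  have le: "\<bar>\<Sum>k. A k * g k\<bar> \<le> K * c" using summable_rabs[OF sAg] by (simp add: Kc)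
  have B0: "0 \<le> (\<Sum>k. A k * \<bar>g k\<bar> powr p)" using A by (intro suminf_nonneg sB) simp
  have c0: "0 \<le> c" using K by (simp add: c_def suminf_nonneg[OF sAg])
  show ?thesis
  proof (cases "c = 0")
    case True
    then show ?thesis using le B0 by simp
  next
    case False
    with c0 have c: "0 < c" by simp
    have eqc: "c powr (p - 1) * c = c powr p"
      using c by (simp add: powr_diff)
    have "(\<Sum>k. p * c powr (p - 1) * \<bar>A k * g k\<bar>)
            \<le> (\<Sum>k. A k * \<bar>g k\<bar> powr p + (p - 1) * c powr p * A k)"
    proof (rule suminf_le)
      fix k
      show "p * c powr (p - 1) * \<bar>A k * g k\<bar> \<le> A k * \<bar>g k\<bar> powr p + (p - 1) * c powr p * A k"
        using mult_left_mono[OF powr_tangent_le[OF p c, of "\<bar>g k\<bar>"] A[of k]] A[of k]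
        by (simp add: abs_mult algebra_simps)
    qed (intro summable_mult summable_add sAg sB sA)+
    also have "\<dots> = (\<Sum>k. A k * \<bar>g k\<bar> powr p) + (p - 1) * c powr p * suminf A"
      by (simp add: suminf_add[OF sB summable_mult[OF sA], symmetric] suminf_mult[OF sA])
    also have "\<dots> \<le> (\<Sum>k. A k * \<bar>g k\<bar> powr p) + (p - 1) * c powr p * K"
      using p AK by (intro add_left_mono mult_left_mono) auto
    finally have "p * c powr (p - 1) * (K * c) \<le> (\<Sum>k. A k * \<bar>g k\<bar> powr p) + (p - 1) * c powr p * K"
      by (simp add: suminf_mult[OF sAg] Kc)
    moreover have "p * c powr (p - 1) * (K * c) = p * K * c powr p"
      unfolding eqc[symmetric] by (simp only: mult_ac)
    ultimately have "p * K * c powr p \<le> (\<Sum>k. A k * \<bar>g k\<bar> powr p) + (p - 1) * c powr p * K"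
      by (simp only:)
    then have *: "K * c powr p \<le> (\<Sum>k. A k * \<bar>g k\<bar> powr p)"
      by (simp add: algebra_simps)
    have "\<bar>\<Sum>k. A k * g k\<bar> powr p \<le> (K * c) powr p"
      using le p by (intro powr_mono2) auto
    also have "\<dots> = K powr (p - 1) * (K * c powr p)"
      using K c by (simp add: powr_mult powr_diff)
    also have "\<dots> \<le> K powr (p - 1) * (\<Sum>k. A k * \<bar>g k\<bar> powr p)"
      using * by (intro mult_left_mono) auto
    finally show ?thesis .
  qed
qed

text \<open>Jensen along each row costs \<open>K powr (p - 1)\<close>; after exchanging the sums,
  the column bound gives the last factor \<open>K\<close>. Rows and columns are bounded through
  finite sums, so their convergence need not be known beforehand.\<close>

lemma schur_test:
  fixes A :: "nat \<Rightarrow> nat \<Rightarrow> real" and W g :: "nat \<Rightarrow> real" and K p :: real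
  assumes p: "1 \<le> p" and K: "0 < K" and A: "\<And>m k. 0 \<le> A m k" and W: "\<And>m. 0 < W m"
    and row: "\<And>m M. (\<Sum>k<M. A m k) \<le> K"
    and col: "\<And>k M. (\<Sum>m<M. W m * A m k) \<le> K * W k"
    and sg: "summable (\<lambda>k. W k * \<bar>g k\<bar> powr p)"
  shows "summable (\<lambda>m. W m * \<bar>\<Sum>k. A m k * g k\<bar> powr p)" (is ?S)
    and "(\<Sum>m. W m * \<bar>\<Sum>k. A m k * g k\<bar> powr p) \<le> K powr p * (\<Sum>k. W k * \<bar>g k\<bar> powr p)" (is ?L)
proof -
  have sA: "summable (A m)" for m
    using A row[of m] by (intro bounded_imp_summable[of _ K]) (simp_all only: lessThan_Suc_atMost[symmetric])
  have sB: "summable (\<lambda>k. A m k * \<bar>g k\<bar> powr p)" for m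
  proof (rule summable_comparison_test'[OF summable_mult[OF sg, of "K / W m"], of 0])
    fix k
    \<comment> \<open>A single entry is at most a partial sum of its column, so row \<open>m\<close>
      is dominated by a multiple of \<open>W\<close>.\<close>
    have "W m * A m k \<le> (\<Sum>i<Suc m. W i * A i k)"
      using W A by (intro member_le_sum) (auto simp: less_imp_le)
    also have "\<dots> \<le> K * W k" by (rule col)
    finally have "A m k \<le> K / W m * W k" using W[of m] by (simp add: field_simps)
    then have "A m k * \<bar>g k\<bar> powr p \<le> K / W m * W k * \<bar>g k\<bar> powr p" by (rule mult_right_mono) simp
    then show "norm (A m k * \<bar>g k\<bar> powr p) \<le> K / W m * (W k * \<bar>g k\<bar> powr p)"
      using A[of m k] by (simp add: abs_mult mult.assoc)
  qed
  have part: "(\<Sum>m<M. W m * \<bar>\<Sum>k. A m k * g k\<bar> powr p) \<le> K powr p * (\<Sum>k. W k * \<bar>g k\<bar> powr p)" for M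
  proof -
    have "(\<Sum>m<M. W m * \<bar>\<Sum>k. A m k * g k\<bar> powr p)
            \<le> (\<Sum>m<M. W m * (K powr (p - 1) * (\<Sum>k. A m k * \<bar>g k\<bar> powr p)))"
      using W by (intro sum_mono mult_left_mono jensen_powr_suminf p K A sA sB)
        (auto intro: suminf_le_const sA row simp: less_imp_le)
    also have "\<dots> = K powr (p - 1) * (\<Sum>m<M. \<Sum>k. W m * (A m k * \<bar>g k\<bar> powr p))"
      by (simp add: sum_distrib_left suminf_mult[OF sB] mult_ac)
    also have "(\<Sum>m<M. \<Sum>k. W m * (A m k * \<bar>g k\<bar> powr p))
                 = (\<Sum>k. \<Sum>m<M. W m * (A m k * \<bar>g k\<bar> powr p))"
      by (intro suminf_sum[symmetric] summable_mult sB)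
    also have "\<dots> \<le> (\<Sum>k. K * (W k * \<bar>g k\<bar> powr p))"
    proof (rule suminf_le)
      fix k
      show "(\<Sum>m<M. W m * (A m k * \<bar>g k\<bar> powr p)) \<le> K * (W k * \<bar>g k\<bar> powr p)"
        using mult_right_mono[OF col[of k M], of "\<bar>g k\<bar> powr p"]
        by (simp add: sum_distrib_right mult.assoc)
    qed (intro summable_sum summable_mult sB sg)+
    also have "\<dots> = K * (\<Sum>k. W k * \<bar>g k\<bar> powr p)" by (rule suminf_mult[OF sg])
    finally have "(\<Sum>m<M. W m * \<bar>\<Sum>k. A m k * g k\<bar> powr p)
        \<le> K powr (p - 1) * (K * (\<Sum>k. W k * \<bar>g k\<bar> powr p))"
      by (simp add: mult_left_mono)
    then show ?thesis using K by (simp add: powr_diff)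
  qed
  show ?S
    using W part by (intro bounded_imp_summable[of _ "K powr p * (\<Sum>k. W k * \<bar>g k\<bar> powr p)"])
      (simp_all add: less_imp_le lessThan_Suc_atMost[symmetric] del: sum.lessThan_Suc)
  then show ?L by (rule suminf_le_const) (rule part)
qed

text \<open>Subtraction is truncated: for \<open>N \<le> m\<close> both sides are zero.\<close>

lemma sum_shift_if:
  fixes F :: "nat \<Rightarrow> 'a :: comm_monoid_add"
  shows "(\<Sum>k<N. if m \<le> k then F (k - m) else 0) = (\<Sum>j<N - m. F j)"
  by (induction N) (auto simp: Suc_diff_le)

section \<open>The \<open>q\<close>-Pochhammer symbol\<close>

context
  fixes q :: real
  assumes q: "0 < q" "q < 1"
begin

lemma qpoch_convergent: "convergent_prod (\<lambda>k. 1 - q ^ k * z)"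
proof (intro abs_convergent_prod_imp_convergent_prod summable_imp_abs_convergent_prod)
  show "summable (\<lambda>k. norm (1 - q ^ k * z - 1))"
    using q by (simp add: abs_mult summable_mult2 summable_geometric)
qed

lemma qpoch_pos:
  assumes "0 \<le> z" "z < 1"
  shows "0 < qpoch z q"
  unfolding qpoch_def
proof (rule less_0_prodinf[OF qpoch_convergent])
  fix k
  have "q ^ k * z \<le> 1 * z" using q assms by (intro mult_right_mono power_le_one) auto
  then show "0 < 1 - q ^ k * z" using assms by simp
qed

lemma qpoch_rec:
  assumes "0 \<le> z" "z < 1"
  shows "qpoch z q = (1 - z) * qpoch (q * z) q"
  using prodinf_split_head[OF qpoch_convergent[of z]] assms
  by (simp add: qpoch_def mult_ac field_simps)

text \<open>One zero factor makes a convergent product zero. This is why the kernel vanishes at grid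
  points t > x.\<close>

lemma qpoch_eq_0:
  assumes "q ^ i * z = 1"
  shows "qpoch z q = 0"
proof -
  have "(\<lambda>k. 1 - q ^ k * z) has_prod qpoch z q"
    unfolding qpoch_def by (rule convergent_prod_has_prod[OF qpoch_convergent])
  then have "qpoch z q = 0 \<longleftrightarrow> 0 \<in> range (\<lambda>k. 1 - q ^ k * z)"
    by (rule has_prod_eq_0_iff)
  moreover have "0 \<in> range (\<lambda>k. 1 - q ^ k * z)"
    using assms by (intro range_eqI[of _ _ i]) simp
  ultimately show ?thesis by simp
qed

section \<open>Jackson integrals along the grid\<close>

text \<open>Starting at \<open>b * q ^ n\<close> skips the first \<open>n\<close> grid points; the
  factor \<open>q ^ n\<close> of the endpoint accounts for the shift of the weights.\<close>

lemma jackson0_grid: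
  assumes "summable (\<lambda>i. q ^ i * \<phi> (b * q ^ i))"
  shows "jackson0 q (b * q ^ n) \<phi> = jackson0 q b \<phi> - (1 - q) * b * (\<Sum>i<n. q ^ i * \<phi> (b * q ^ i))"
proof -
  have eq: "q ^ (i + n) * \<phi> (b * q ^ (i + n)) = q ^ n * (q ^ i * \<phi> (b * q ^ n * q ^ i))" for i
    by (simp add: power_add mult_ac)
  have "summable (\<lambda>i. q ^ (i + n) * \<phi> (b * q ^ (i + n)))"
    using summable_ignore_initial_segment[OF assms, of n] .
  then have "summable (\<lambda>i. q ^ i * \<phi> (b * q ^ n * q ^ i))"
    using q unfolding eq by (simp add: summable_mult_D)
  from suminf_mult[OF this, of "q ^ n"]
  have "(\<Sum>i. q ^ i * \<phi> (b * q ^ i))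
          = q ^ n * (\<Sum>i. q ^ i * \<phi> (b * q ^ n * q ^ i)) + (\<Sum>i<n. q ^ i * \<phi> (b * q ^ i))"
    using suminf_split_initial_segment[OF assms, of n] unfolding eq by simp
  then show ?thesis by (simp add: jackson0_def algebra_simps)
qed

text \<open>The integral up to \<open>a\<close> vanishes through its prefactor if
  \<open>a = 0\<close>, and cancels the tail from index \<open>n\<close> on if
  \<open>a = b * q ^ n\<close>. The test \<open>a < b * q ^ i\<close> covers both cases.\<close>

lemma jackson_grid:
  assumes b: "0 < b" and a: "a = 0 \<or> (\<exists>n. a = b * q ^ n)"
    and s: "summable (\<lambda>i. q ^ i * \<phi> (b * q ^ i))"
  shows "jackson q a b \<phi> = (1 - q) * b * (\<Sum>i. if a < b * q ^ i then q ^ i * \<phi> (b * q ^ i) else 0)"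
  using a
proof (elim disjE exE)
  assume "a = 0"
  then show ?thesis using b q by (simp add: jackson_def jackson0_def)
next
  fix n assume n: "a = b * q ^ n"
  have "a < b * q ^ i \<longleftrightarrow> i < n" for i
    using b q by (simp add: n power_strict_decreasing_iff)
  then have "(\<Sum>i. if a < b * q ^ i then q ^ i * \<phi> (b * q ^ i) else 0)
               = (\<Sum>i. if i < n then q ^ i * \<phi> (b * q ^ i) else 0)" by simp
  also have "\<dots> = (\<Sum>i<n. q ^ i * \<phi> (b * q ^ i))"
    by (subst suminf_finite[of "{..<n}"]) auto
  finally show ?thesis using jackson0_grid[OF s, of n] by (simp add: jackson_def n)
qed

section \<open>The kernel of the fractional integral\<close>

context
  fixes \<alpha> :: real
  assumes \<alpha>: "0 < \<alpha>"
begin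

lemma qpowr_less_1: "q powr \<alpha> < 1"
  using q \<alpha> powr_less_mono2[of \<alpha> q 1] by simp

text \<open>\<open>qratio y\<close> is \<open>(1 - y)\<^sub>q\<^sup>\<alpha>\<close>, and \<open>qweight j\<close> is the kernel \<open>(1 - q t)\<^sub>q\<^sup>\<alpha>\<^sup>-\<^sup>1\<close> at \<open>t = q\<^sup>j\<close>.\<close>

definition qratio :: "real \<Rightarrow> real" where
  "qratio y = qpoch y q / qpoch (q powr \<alpha> * y) q"

definition qweight :: "nat \<Rightarrow> real" where
  "qweight j = qpoch (q ^ Suc j) q / qpoch (q powr \<alpha> * q ^ j) q"

lemma qpowr_mult_power: "0 < q powr \<alpha> * q ^ j" "q powr \<alpha> * q ^ j < 1"
proof -
  show "0 < q powr \<alpha> * q ^ j" using q by simp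
  have "q powr \<alpha> * q ^ j \<le> q powr \<alpha> * 1" using q by (intro mult_left_mono power_le_one) auto
  then show "q powr \<alpha> * q ^ j < 1" using qpowr_less_1 by simp
qed

lemma qweight_pos: "0 < qweight j"
  using q unfolding qweight_def
  by (intro divide_pos_pos qpoch_pos qpowr_mult_power less_imp_le[OF qpowr_mult_power(1)])
    (auto simp: power_Suc_less_one simp del: power_Suc)

lemma qratio_1: "qratio 1 = 0"
  using qpoch_eq_0[of 0 1] by (simp add: qratio_def)

lemma qratio_pos: "0 \<le> y \<Longrightarrow> y < 1 \<Longrightarrow> 0 < qratio y"
  unfolding qratio_def using qpowr_less_1 mult_left_le_one_le[of y "q powr \<alpha>"]
  by (intro divide_pos_pos qpoch_pos) auto

lemma qpoch_power_rec:
  "qpoch (q powr \<alpha> * q ^ j) q = (1 - q powr \<alpha> * q ^ j) * qpoch (q powr \<alpha> * q ^ Suc j) q"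
  using qpoch_rec[of "q powr \<alpha> * q ^ j"] qpowr_mult_power[of j] by (simp add: mult_ac)

text \<open>Comes from the recursion of the denominator; \<open>qratio_power\<close> uses that of
  the numerator. Together they express two consecutive values through the same weight, which makes
  the sums below telescope.\<close>

lemma qratio_power_Suc:
  "qratio (q ^ Suc j) = (1 - q powr \<alpha> * q ^ j) * qweight j"
  using qpowr_mult_power[of j] qpoch_pos[OF less_imp_le[OF qpowr_mult_power(1)] qpowr_mult_power(2), of "Suc j"]
  unfolding qratio_def qweight_def qpoch_power_rec[of j] by simp

lemma qratio_power:
  "qratio (q ^ j) = (1 - q ^ j) * qweight j"
proof (cases j)
  case 0
  then show ?thesis by (simp add: qratio_1)
next
  case (Suc i)
  then have "q ^ j < 1" "0 \<le> q ^ j" using q power_Suc_less_one[of q i] by auto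
  then have "qpoch (q ^ j) q = (1 - q ^ j) * qpoch (q ^ Suc j) q" using qpoch_rec[of "q ^ j"] by simp
  then show ?thesis by (simp add: qratio_def qweight_def)
qed

lemma qratio_power_mono:
  assumes "i \<le> j"
  shows "qratio (q ^ i) \<le> qratio (q ^ j)"
proof (rule lift_Suc_mono_le[OF _ assms])
  fix n
  have "q powr \<alpha> * q ^ n \<le> 1 * q ^ n" using q qpowr_less_1 by (intro mult_right_mono) auto
  then have "(1 - q ^ n) * qweight n \<le> (1 - q powr \<alpha> * q ^ n) * qweight n"
    using qweight_pos[of n] by (intro mult_right_mono) auto
  then show "qratio (q ^ n) \<le> qratio (q ^ Suc n)"
    by (simp only: qratio_power[of n] qratio_power_Suc[of n])
qed

text \<open>Factor by factor, the numerator is at most the denominator, while at 0 they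
  agree.\<close>

lemma qratio_le_qratio_0:
  assumes "0 \<le> y" "y \<le> 1"
  shows "qratio y \<le> qratio 0"
proof (cases "y = 1")
  case True
  then show ?thesis using qratio_pos[of 0] by (simp add: qratio_1)
next
  case False
  have y: "q powr \<alpha> * y \<le> y" using assms qpowr_less_1 by (intro mult_left_le_one_le) auto
  have "qpoch y q \<le> qpoch (q powr \<alpha> * y) q"
  proof (rule has_prod_le)
    fix k
    have "q ^ k * y \<le> 1" using q assms by (intro mult_le_one power_le_one) auto
    moreover have "q ^ k * (q powr \<alpha> * y) \<le> q ^ k * y" using q y by (intro mult_left_mono) auto
    ultimately show "0 \<le> 1 - q ^ k * y \<and> 1 - q ^ k * y \<le> 1 - q ^ k * (q powr \<alpha> * y)" by simp
  qed (unfold qpoch_def, (rule convergent_prod_has_prod[OF qpoch_convergent])+)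
  moreover have "0 < qpoch (q powr \<alpha> * y) q" using False assms y by (intro qpoch_pos) auto
  moreover have "0 < qpoch 0 q" by (intro qpoch_pos) auto
  ultimately show ?thesis by (simp add: qratio_def)
qed

text \<open>Telescopes from \<open>qratio 1 = 0\<close>, since \<open>(1 - q powr \<alpha> * q ^ N)
  - (1 - q ^ N) = (1 - q powr \<alpha>) * q ^ N\<close>.\<close>

lemma qweight_row_sum:
  "(\<Sum>j<N. q ^ j * qweight j) = qratio (q ^ N) / (1 - q powr \<alpha>)"
proof (induction N)
  case 0
  show ?case by (simp add: qratio_1)
next
  case (Suc N)
  have "qratio (q ^ Suc N) = qratio (q ^ N) + (1 - q powr \<alpha>) * (q ^ N * qweight N)"
    unfolding qratio_power_Suc qratio_power[of N] by (simp add: algebra_simps)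
  then show ?case using Suc qpowr_less_1 by (simp only: sum.lessThan_Suc) (simp add: add_divide_distrib del: power_Suc)
qed

text \<open>A convolution: splitting off \<open>m = 0\<close> leaves \<open>q powr \<alpha>\<close>
  times the previous sum.\<close>

lemma qweight_column_sum:
  "(\<Sum>m<Suc k. (q powr \<alpha>) ^ m * qweight (k - m)) = qratio (q ^ Suc k) / (1 - q powr \<alpha>)"
proof (induction k)
  case 0
  have "qratio (q ^ Suc 0) = (1 - q powr \<alpha>) * qweight 0"
    using qratio_power_Suc[of 0] by simp
  then show ?case using qpowr_less_1 by simp
next
  case (Suc k)
  have "(\<Sum>m<Suc (Suc k). (q powr \<alpha>) ^ m * qweight (Suc k - m))
      = qweight (Suc k) + q powr \<alpha> * (\<Sum>m<Suc k. (q powr \<alpha>) ^ m * qweight (k - m))"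
    by (subst sum.lessThan_Suc_shift) (simp add: sum_distrib_left mult.assoc distrib_left)
  also have "\<dots> = qweight (Suc k) + q powr \<alpha> * qratio (q ^ Suc k) / (1 - q powr \<alpha>)"
    unfolding Suc by simp
  also have "\<dots> = ((1 - q powr \<alpha>) * qweight (Suc k) + q powr \<alpha> * qratio (q ^ Suc k)) / (1 - q powr \<alpha>)"
    using qpowr_less_1 by (simp add: field_simps)
  also have "(1 - q powr \<alpha>) * qweight (Suc k) + q powr \<alpha> * qratio (q ^ Suc k) = qratio (q ^ Suc (Suc k))"
    unfolding qratio_power_Suc[of "Suc k"] qratio_power[of "Suc k"]
    by (simp add: algebra_simps)
  finally show ?case .
qed

lemma qratio_0: "qratio 0 = 1"
  using qpoch_pos[of 0] by (simp add: qratio_def)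

text \<open>The weight is the term \<open>m = 0\<close> of a column sum with nonnegative terms. The
  bound is uniform in \<open>k\<close>, as convergence of the integral requires.\<close>

lemma qweight_le: "qweight k \<le> 1 / (1 - q powr \<alpha>)"
proof -
  have "(q powr \<alpha>) ^ 0 * qweight (k - 0) \<le> (\<Sum>m<Suc k. (q powr \<alpha>) ^ m * qweight (k - m))"
    using q by (intro member_le_sum) (auto simp: less_imp_le[OF qweight_pos])
  also have "\<dots> = qratio (q ^ Suc k) / (1 - q powr \<alpha>)" by (rule qweight_column_sum)
  also have "\<dots> \<le> 1 / (1 - q powr \<alpha>)"
    using qratio_le_qratio_0[of "q ^ Suc k"] qpowr_less_1 q power_le_one[of q "Suc k"]
    by (intro divide_right_mono) (auto simp: qratio_0 simp del: power_Suc)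
  finally show ?thesis by simp
qed

lemma qGamma_pos: "0 < qGamma q \<alpha>"
  using q qpowr_less_1 unfolding qGamma_def
  by (intro mult_pos_pos divide_pos_pos qpoch_pos) auto

text \<open>The functional equation; it accounts for the denominator
  \<open>1 - q powr \<alpha>\<close> of the telescoped sums.\<close>

lemma qGamma_add_1: "qGamma q (\<alpha> + 1) = qGamma q \<alpha> * (1 - q powr \<alpha>) / (1 - q)"
proof -
  have e: "q powr (\<alpha> + 1) = q * q powr \<alpha>" using q by (simp add: powr_add)
  have rec: "qpoch (q powr \<alpha>) q = (1 - q powr \<alpha>) * qpoch (q * q powr \<alpha>) q"
    using qpowr_less_1 by (intro qpoch_rec) auto
  have pw: "(1 - q) powr (1 - \<alpha>) = (1 - q) * (1 - q) powr (1 - (\<alpha> + 1))"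
    using q powr_add[of "1 - q" 1 "- \<alpha>"] by simp
  show ?thesis
    using q \<alpha> qpowr_less_1 unfolding qGamma_def e rec pw by simp
qed

lemma qpower_grid:
  assumes b: "0 < b"
  shows "qpower q (b * q ^ m) (q * (b * q ^ i)) (\<alpha> - 1)
           = (if m \<le> i then (b * q ^ m) powr (\<alpha> - 1) * qweight (i - m) else 0)"
proof (cases "m \<le> i")
  case True
  then have "q * (b * q ^ i) / (b * q ^ m) = q ^ Suc (i - m)"
    using b q by (simp add: power_diff)
  moreover have "q powr (\<alpha> - 1) * q ^ Suc (i - m) = q powr \<alpha> * q ^ (i - m)"
    using q by (simp add: powr_diff)
  ultimately show ?thesis using True by (simp only: qpower_def qweight_def if_True)
next
  case False
  \<comment> \<open>The factor of index \<open>m - Suc i\<close> in the numerator of the kernel is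
    zero.\<close>
  then have "m = i + Suc (m - Suc i)" by simp
  then have "q ^ m = q ^ i * (q * q ^ (m - Suc i))" by (metis power_Suc power_add)
  then have "q ^ (m - Suc i) * (q * (b * q ^ i) / (b * q ^ m)) = 1"
    using b q by simp
  then show ?thesis using False by (simp add: qpower_def qpoch_eq_0)
qed

section \<open>The matrix of the fractional integral\<close>

text \<open>Kernel times Jackson mass \<open>(1 - q) * b * q ^ k\<close>, over
  \<open>qGamma q \<alpha>\<close>; the powers of \<open>b\<close> and \<open>q\<close> are
  regrouped so that row and column sums can be read off.\<close>

definition qmatrix :: "real \<Rightarrow> real \<Rightarrow> nat \<Rightarrow> nat \<Rightarrow> real" where
  "qmatrix a b m k = (if m \<le> k \<and> a < b * q ^ k
     then (1 - q) / qGamma q \<alpha> * b powr \<alpha> * (q powr \<alpha>) ^ m * (q ^ (k - m) * qweight (k - m)) else 0)"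

lemma qmatrix_nonneg: "0 \<le> qmatrix a b m k"
  using q qGamma_pos qweight_pos[of "k - m"] by (simp add: qmatrix_def)

context
  fixes a b :: real
  assumes b: "0 < b" and grid: "a = 0 \<or> (\<exists>n. a = b * q ^ n)"
begin

text \<open>The cutoff at \<open>a\<close> is kept twice: in the matrix it yields row and column
  bounds depending on \<open>a\<close>, in the vector it yields the norm over [a, b].\<close>

lemma RL_qint_grid:
  assumes sf: "summable (\<lambda>i. q ^ i * \<bar>f (b * q ^ i)\<bar>)"
  shows "RL_qint q \<alpha> a f (b * q ^ m)
           = (\<Sum>k. qmatrix a b m k * (if a < b * q ^ k then f (b * q ^ k) else 0))"
proof -
  define \<phi> where "\<phi> = (\<lambda>t. qpower q (b * q ^ m) (q * t) (\<alpha> - 1) * f t)"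
  have \<phi>: "\<phi> (b * q ^ i) = (if m \<le> i then (b * q ^ m) powr (\<alpha> - 1) * qweight (i - m) * f (b * q ^ i) else 0)" for i
    using qpower_grid[OF b, of m i] by (simp add: \<phi>_def)
  define c where "c = (b * q ^ m) powr (\<alpha> - 1)"
  have c: "0 \<le> c" by (simp add: c_def)
  have sabs: "summable (\<lambda>i. \<bar>q ^ i * \<phi> (b * q ^ i)\<bar>)"
  proof (rule summable_comparison_test'[OF summable_mult[OF sf, of "c * (1 / (1 - q powr \<alpha>))"], of 0])
    fix i
    have "\<bar>\<phi> (b * q ^ i)\<bar> \<le> c * qweight (i - m) * \<bar>f (b * q ^ i)\<bar>"
      using qweight_pos[of "i - m"] c by (simp add: \<phi> abs_mult c_def[symmetric])
    also have "\<dots> \<le> c * (1 / (1 - q powr \<alpha>)) * \<bar>f (b * q ^ i)\<bar>"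
      by (intro mult_right_mono mult_left_mono qweight_le c) simp
    finally have "q ^ i * \<bar>\<phi> (b * q ^ i)\<bar> \<le> q ^ i * (c * (1 / (1 - q powr \<alpha>)) * \<bar>f (b * q ^ i)\<bar>)"
      using q by (intro mult_left_mono) auto
    then show "norm \<bar>q ^ i * \<phi> (b * q ^ i)\<bar> \<le> c * (1 / (1 - q powr \<alpha>)) * (q ^ i * \<bar>f (b * q ^ i)\<bar>)"
      using q by (simp add: abs_mult mult_ac)
  qed
  then have s: "summable (\<lambda>i. q ^ i * \<phi> (b * q ^ i))" by (rule summable_rabs_cancel)
  \<comment> \<open>The kernel vanishes at \<open>t = b * q ^ i\<close> for \<open>i < m\<close>, so the upper limit may be moved from \<open>b * q ^ m\<close> to \<open>b\<close>.\<close>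
  have "jackson0 q (b * q ^ m) \<phi> = jackson0 q b \<phi>"
    by (subst jackson0_grid[OF s]) (simp add: \<phi>)
  then have "RL_qint q \<alpha> a f (b * q ^ m) = 1 / qGamma q \<alpha> * jackson q a b \<phi>"
    by (simp add: RL_qint_def jackson_def \<phi>_def)
  also have "\<dots> = (1 - q) / qGamma q \<alpha> * b * (\<Sum>i. if a < b * q ^ i then q ^ i * \<phi> (b * q ^ i) else 0)"
    by (simp add: jackson_grid[OF b grid s])
  also have "\<dots> = (\<Sum>i. (1 - q) / qGamma q \<alpha> * b * (if a < b * q ^ i then q ^ i * \<phi> (b * q ^ i) else 0))"
  proof (rule suminf_mult[symmetric])
    show "summable (\<lambda>i. if a < b * q ^ i then q ^ i * \<phi> (b * q ^ i) else 0)"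
      by (rule summable_comparison_test'[OF sabs, of 0]) auto
  qed
  also have "\<dots> = (\<Sum>k. qmatrix a b m k * (if a < b * q ^ k then f (b * q ^ k) else 0))"
  proof (rule suminf_cong)
    fix k
    have "b * q ^ k * (b * q ^ m) powr (\<alpha> - 1) = b powr \<alpha> * (q powr \<alpha>) ^ m * q ^ (k - m)" if "m \<le> k"
    proof -
      have "(b * q ^ m) powr (\<alpha> - 1) = (b * q ^ m) powr \<alpha> / (b * q ^ m)"
        using b q by (simp add: powr_diff)
      moreover have "(b * q ^ m) powr \<alpha> = b powr \<alpha> * (q powr \<alpha>) ^ m"
        using b q by (simp add: powr_mult powr_power powr_realpow[symmetric] powr_powr mult.commute)
      moreover have "q ^ k = q ^ m * q ^ (k - m)" using that by (simp flip: power_add)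
      ultimately show ?thesis using b q by simp
    qed
    then show "(1 - q) / qGamma q \<alpha> * b * (if a < b * q ^ k then q ^ k * \<phi> (b * q ^ k) else 0)
        = qmatrix a b m k * (if a < b * q ^ k then f (b * q ^ k) else 0)"
      by (simp add: qmatrix_def \<phi> mult.assoc)
  qed
  finally show ?thesis .
qed

text \<open>If \<open>a = b * q ^ n\<close>, then \<open>k < n\<close> and
  \<open>q * a / b = q ^ Suc n\<close>, so monotonicity along the powers of \<open>q\<close>
  applies; \<open>a = 0\<close> is the limiting case.\<close>

lemma qratio_grid_le:
  assumes "a < b * q ^ k"
  shows "qratio (q ^ Suc k) \<le> qratio (q * a / b)"
  using grid
proof (elim disjE exE)
  assume "a = 0"
  then show ?thesis using q power_le_one[of q "Suc k"] by (auto intro!: qratio_le_qratio_0 simp del: power_Suc)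
next
  fix n assume n: "a = b * q ^ n"
  then have "k < n" using assms b q by (simp add: power_strict_decreasing_iff)
  then show ?thesis using qratio_power_mono[of "Suc k" "Suc n"] b by (simp add: n)
qed

text \<open>Puts the constant of the theorem into the shape of the telescoped sums.\<close>

lemma qmatrix_bound_eq:
  "qpower q b (q * a) \<alpha> / qGamma q (\<alpha> + 1)
     = (1 - q) / qGamma q \<alpha> * b powr \<alpha> * (qratio (q * a / b) / (1 - q powr \<alpha>))"
  using q qpowr_less_1 qGamma_pos by (simp add: qpower_def qratio_def qGamma_add_1 mult_ac)

lemma qmatrix_bound_pos:
  assumes "a < b"
  shows "0 < qpower q b (q * a) \<alpha> / qGamma q (\<alpha> + 1)"
proof -
  have "0 \<le> a" using grid b q by auto
  then have "q * a \<le> a" using q by (simp add: mult_left_le_one_le)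
  then have "0 < qratio (q * a / b)" using b assms q \<open>0 \<le> a\<close> by (intro qratio_pos) auto
  then show ?thesis
    unfolding qmatrix_bound_eq using q b qGamma_pos qpowr_less_1
    by (intro mult_pos_pos divide_pos_pos) auto
qed

text \<open>The induction only discards trailing zeros. Once entry \<open>M\<close> lies in the
  support, all earlier grid points lie above \<open>a\<close> too, the cutoff disappears and the sum
  telescopes.\<close>

lemma qmatrix_row_sum_le:
  assumes "a < b"
  shows "(\<Sum>k<M. qmatrix a b m k) \<le> qpower q b (q * a) \<alpha> / qGamma q (\<alpha> + 1)"
proof (induction M)
  case 0
  show ?case using qmatrix_bound_pos[OF assms] by simp
next
  case (Suc M)
  show ?case
  proof (cases "m \<le> M \<and> a < b * q ^ M")
    case False
    then have "qmatrix a b m M = 0" by (simp only: qmatrix_def if_False)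
    then show ?thesis using Suc by simp
  next
    case True
    define D where "D = (1 - q) / qGamma q \<alpha> * b powr \<alpha>"
    have D: "0 \<le> D" using q qGamma_pos by (simp add: D_def)
    have "a < b * q ^ k" if "k < Suc M" for k
    proof -
      have "b * q ^ M \<le> b * q ^ k" using that b q by (intro mult_left_mono power_decreasing) auto
      then show ?thesis using True by simp
    qed
    then have "(\<Sum>k<Suc M. qmatrix a b m k)
        = (\<Sum>k<Suc M. D * (q powr \<alpha>) ^ m * (if m \<le> k then q ^ (k - m) * qweight (k - m) else 0))"
      by (intro sum.cong refl) (auto simp: qmatrix_def D_def)
    also have "\<dots> = D * (q powr \<alpha>) ^ m * (\<Sum>j<Suc M - m. q ^ j * qweight j)"
      unfolding sum_distrib_left[symmetric] by (subst sum_shift_if) (rule refl)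
    also have "\<dots> = D * (q powr \<alpha>) ^ m * (qratio (q ^ (Suc M - m)) / (1 - q powr \<alpha>))"
      by (simp only: qweight_row_sum)
    also have "\<dots> \<le> D * 1 * (qratio (q * a / b) / (1 - q powr \<alpha>))"
    proof (intro mult_mono divide_right_mono)
      show "(q powr \<alpha>) ^ m \<le> 1" using qpowr_less_1 by (intro power_le_one) auto
      have "qratio (q ^ (Suc M - m)) \<le> qratio (q ^ Suc M)" by (rule qratio_power_mono) simp
      then show "qratio (q ^ (Suc M - m)) \<le> qratio (q * a / b)" using qratio_grid_le[of M] True by simp
      have "0 < qratio (q ^ (Suc M - m))"
        using True q by (intro qratio_pos) (auto simp: Suc_diff_le power_Suc_less_one simp del: power_Suc)
      then show "0 \<le> qratio (q ^ (Suc M - m)) / (1 - q powr \<alpha>)" using qpowr_less_1 by simp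
    qed (use D qpowr_less_1 in auto)
    finally show ?thesis unfolding qmatrix_bound_eq by (simp only: D_def mult_1_right)
  qed
qed

text \<open>The weight \<open>q ^ m\<close> merges with \<open>q ^ (k - m)\<close> into
  \<open>q ^ k\<close>, leaving the convolution of \<open>qweight_column_sum\<close>.\<close>

lemma qmatrix_column_sum_le:
  assumes "a < b"
  shows "(\<Sum>m<M. q ^ m * qmatrix a b m k) \<le> qpower q b (q * a) \<alpha> / qGamma q (\<alpha> + 1) * q ^ k"
proof (cases "a < b * q ^ k")
  case False
  then have "qmatrix a b m k = 0" for m by (simp add: qmatrix_def)
  then show ?thesis using mult_nonneg_nonneg[OF less_imp_le[OF qmatrix_bound_pos[OF assms]], of "q ^ k"] q by simp
next
  case True
  define D where "D = (1 - q) / qGamma q \<alpha> * b powr \<alpha> * q ^ k"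
  have D: "0 \<le> D" using q qGamma_pos by (simp add: D_def)
  have nn: "0 \<le> q ^ m * qmatrix a b m k" for m using q by (simp add: qmatrix_nonneg)
  \<comment> \<open>Enlarging the range past \<open>k\<close> and dropping the zero entries below
    the diagonal gives the complete column, whatever \<open>M\<close> is.\<close>
  have "(\<Sum>m<M. q ^ m * qmatrix a b m k) \<le> (\<Sum>m<max M (Suc k). q ^ m * qmatrix a b m k)"
    using nn by (intro sum_mono2) auto
  also have "\<dots> = (\<Sum>m<Suc k. q ^ m * qmatrix a b m k)"
    by (intro sum.mono_neutral_right) (auto simp: qmatrix_def)
  also have "\<dots> = (\<Sum>m<Suc k. D * ((q powr \<alpha>) ^ m * qweight (k - m)))"
  proof (intro sum.cong refl)
    fix m assume "m \<in> {..<Suc k}"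
    then have "m \<le> k" by simp
    then have "q ^ k = q ^ m * q ^ (k - m)" by (simp flip: power_add)
    then show "q ^ m * qmatrix a b m k = D * ((q powr \<alpha>) ^ m * qweight (k - m))"
      using True \<open>m \<le> k\<close> by (simp add: qmatrix_def D_def)
  qed
  also have "\<dots> = D * (qratio (q ^ Suc k) / (1 - q powr \<alpha>))"
    unfolding sum_distrib_left[symmetric] qweight_column_sum ..
  also have "\<dots> \<le> D * (qratio (q * a / b) / (1 - q powr \<alpha>))"
    using D qpowr_less_1 qratio_grid_le[OF True] by (intro mult_left_mono divide_right_mono) auto
  finally show ?thesis unfolding qmatrix_bound_eq by (simp add: D_def mult_ac)
qed

end
end
end

theorem lemma2p6:
  fixes q a b \<alpha> p :: real
  assumes "0 < q" and "q < 1"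
    and "0 \<le> a" and "a < b"
    and "\<alpha> > 0" and "1 \<le> p"
    and "Lq_norm_well_defined q p a b"
  shows "\<forall>f \<in> Lq q p a b.
           RL_qint q \<alpha> a f \<in> Lq q p a b \<and>
           Lq_norm q p a b (RL_qint q \<alpha> a f)
             \<le> qpower q b (q * a) \<alpha> / qGamma q (\<alpha> + 1) * Lq_norm q p a b f"
proof
  fix f assume f: "f \<in> Lq q p a b"
  note q = assms(1,2) and \<alpha> = assms(5) and p = assms(6)
  have b: "0 < b" using assms by simp
  have grid: "a = 0 \<or> (\<exists>n. a = b * q ^ n)"
    using Lq_norm_well_defined_iff assms by blast
  define K where "K = qpower q b (q * a) \<alpha> / qGamma q (\<alpha> + 1)"
  have K: "0 < K" unfolding K_def by (rule qmatrix_bound_pos[OF q \<alpha> b grid assms(4)])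
  define R where "R = RL_qint q \<alpha> a f"
  define g where "g k = (if a < b * q ^ k then f (b * q ^ k) else 0)" for k
  define A where "A = qmatrix q \<alpha> a b"
  have sf: "summable (\<lambda>i. q ^ i * \<bar>f (b * q ^ i)\<bar> powr p)"
    using f by (simp add: Lq_def jackson_integrable_def)
  have "summable (\<lambda>i. q ^ i + q ^ i * \<bar>f (b * q ^ i)\<bar> powr p)"
    using q by (intro summable_add sf) (simp add: summable_geometric)
  then have "summable (\<lambda>i. q ^ i * \<bar>f (b * q ^ i)\<bar>)"
  proof (rule summable_comparison_test'[of _ 0])
    fix i
    show "norm (q ^ i * \<bar>f (b * q ^ i)\<bar>) \<le> q ^ i + q ^ i * \<bar>f (b * q ^ i)\<bar> powr p"
      using mult_left_mono[OF abs_le_one_plus_powr[OF p], of "q ^ i" "f (b * q ^ i)"] q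
      by (simp add: abs_mult distrib_left)
  qed
  then have R: "R (b * q ^ m) = (\<Sum>k. A m k * g k)" for m
    unfolding R_def A_def g_def by (rule RL_qint_grid[OF q \<alpha> b grid])
  have sg: "summable (\<lambda>k. q ^ k * \<bar>g k\<bar> powr p)"
    using q by (intro summable_comparison_test'[OF sf, of 0]) (auto simp: g_def)
  have "0 < q ^ m" for m using q by simp
  note schur = schur_test[where A = A and W = "\<lambda>m. q ^ m", OF p K qmatrix_nonneg[OF q \<alpha>, of a b, folded A_def] this
    qmatrix_row_sum_le[OF q \<alpha> b grid assms(4), folded A_def K_def]
    qmatrix_column_sum_le[OF q \<alpha> b grid assms(4), folded A_def K_def] sg]
  have sR: "summable (\<lambda>m. q ^ m * \<bar>R (b * q ^ m)\<bar> powr p)"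
    using schur(1) by (simp add: R)
  \<comment> \<open>Membership also asks for convergence along \<open>a * q ^ m\<close>: a geometric
    series if \<open>a = 0\<close>, otherwise a rescaled tail of the series at
    \<open>b\<close>.\<close>
  have "summable (\<lambda>m. q ^ m * \<bar>R (a * q ^ m)\<bar> powr p)"
    using grid
  proof (elim disjE exE)
    assume "a = 0"
    then show ?thesis using q by (simp add: summable_mult2 summable_geometric)
  next
    fix n assume n: "a = b * q ^ n"
    have "(\<lambda>m. q ^ (m + n) * \<bar>R (b * q ^ (m + n))\<bar> powr p)
            = (\<lambda>m. q ^ n * (q ^ m * \<bar>R (a * q ^ m)\<bar> powr p))"
      by (simp add: fun_eq_iff n power_add mult_ac)
    then have "summable (\<lambda>m. q ^ n * (q ^ m * \<bar>R (a * q ^ m)\<bar> powr p))"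
      using summable_ignore_initial_segment[OF sR, of n] by simp
    then show ?thesis by (rule summable_mult_D) (use q in simp)
  qed
  with sR have mem: "R \<in> Lq q p a b" by (simp add: Lq_def jackson_integrable_def)
  \<comment> \<open>The norm over [a, b] sees only grid points above \<open>a\<close>; the Schur
    bound covers the whole grid, where the other terms are nonnegative.\<close>
  have nR: "(\<Sum>m. if a < b * q ^ m then q ^ m * \<bar>R (b * q ^ m)\<bar> powr p else 0)
      \<le> (\<Sum>m. q ^ m * \<bar>R (b * q ^ m)\<bar> powr p)"
    using q by (intro suminf_le sR summable_comparison_test'[OF sR, of 0]) auto
  also have "\<dots> \<le> K powr p * (\<Sum>k. q ^ k * \<bar>g k\<bar> powr p)"
    using schur(2) by (simp add: R)
  also have "(\<Sum>k. q ^ k * \<bar>g k\<bar> powr p)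
      = (\<Sum>k. if a < b * q ^ k then q ^ k * \<bar>f (b * q ^ k)\<bar> powr p else 0)"
    using p by (intro suminf_cong) (simp add: g_def)
  finally have "(1 - q) * b * (\<Sum>m. if a < b * q ^ m then q ^ m * \<bar>R (b * q ^ m)\<bar> powr p else 0)
      \<le> (1 - q) * b * (K powr p * (\<Sum>k. if a < b * q ^ k then q ^ k * \<bar>f (b * q ^ k)\<bar> powr p else 0))"
    using q b by (intro mult_left_mono) auto
  then have "jackson q a b (\<lambda>x. \<bar>R x\<bar> powr p) \<le> K powr p * jackson q a b (\<lambda>x. \<bar>f x\<bar> powr p)"
    by (simp add: jackson_grid[OF q b grid] sR sf mult_ac)
  \<comment> \<open>Nonnegativity justifies taking p-th roots on both sides and splitting the root
    of the product.\<close>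
  moreover have "0 \<le> jackson q a b (\<lambda>x. \<bar>R x\<bar> powr p)" "0 \<le> jackson q a b (\<lambda>x. \<bar>f x\<bar> powr p)"
    using assms(7) mem f by (auto simp: Lq_norm_well_defined_def)
  ultimately have "Lq_norm q p a b R \<le> (K powr p * jackson q a b (\<lambda>x. \<bar>f x\<bar> powr p)) powr (1 / p)"
    unfolding Lq_norm_def using p by (intro powr_mono2) auto
  also have "\<dots> = K * Lq_norm q p a b f"
    using K p \<open>0 \<le> jackson q a b (\<lambda>x. \<bar>f x\<bar> powr p)\<close> by (simp add: Lq_norm_def powr_mult powr_powr)
  finally show "RL_qint q \<alpha> a f \<in> Lq q p a b \<and> Lq_norm q p a b (RL_qint q \<alpha> a f)
      \<le> qpower q b (q * a) \<alpha> / qGamma q (\<alpha> + 1) * Lq_norm q p a b f"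
    using mem by (simp add: R_def K_def)
qed

end
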